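(* If a metric space $X$ is not macro-connected, then for each separable metric space $Y$ there is a surjective macro-uniform multi-map $\Phi:X\Rightarrow Y$.
   Context: Multi-maps: a multi-map $\Phi:X\Rightarrow Y$ between sets $X,Y$ is any subset $\Phi\subset X\times Y$. For $A\subset X$, $\Phi(A)=\{y\in Y:\exists a\in A\text{ with }(a,y)\in\Phi\}$. $\Phi$ is surjective if $\Phi(X)=Y$. For metric spaces $X,Y$ the oscillation of $\Phi$ is the function $\omega_\Phi:[0,\infty)\to[0,\infty]$, $\omega_\Phi(\delta)=\sup\{\operatorname{diam}(\Phi(A)):A\subset X,\ \operatorname{diam}(A)\le\delta\}$. $\Phi$ is macro-uniform if $\omega_\Phi(\delta)$ is finite for every $\delta<\infty$. Macro-connectedness: for $\varepsilon\in[0,\infty)$ and a point $x$ of a metric space $X$ with metric $d$, the $\varepsilon$-connected component $C_\varepsilon(x)$ is the set of all $y\in X$ that can be linked with $x$ by a finite sequence of points $x=x_0,\dots,x_n=y$ of $X$ such that $d(x_{i-1},x_i)\le\varepsilon$ for all $1\le i\le n$. A metric space $X$ is macro-connected if $C_\varepsilon(x)=X$ for some $x\in X$ and some $\varepsilon<\infty$. *)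

theory Defs
  imports "HOL-Analysis.Analysis"
begin

text \<open>A metric space is a carrier set \<open>X\<close> with a distance \<open>d\<close> satisfying the locale
  \<open>Metric_space X d\<close>. A multi-map \<open>X \<Rightarrow> Y\<close> is a relation \<open>\<Phi> \<subseteq> X \<times> Y\<close>, and \<open>\<Phi>(A)\<close> is the
  library's relational image \<open>\<Phi> `` A\<close>.\<close>

text \<open>The diameter takes values in \<open>[0,\<infinity>]\<close>: it is infinite on unbounded sets and
  \<open>0\<close> on the empty set. (The library's real-valued \<open>diameter\<close> has no infinite value.)\<close>

definition ediam :: "('a \<Rightarrow> 'a \<Rightarrow> real) \<Rightarrow> 'a set \<Rightarrow> ennreal" where
  "ediam d A = (SUP x\<in>A. SUP y\<in>A. ennreal (d x y))"

text \<open>The oscillation is only meaningful for \<open>\<delta> \<ge> 0\<close>.\<close>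

definition oscillation ::
  "'a set \<Rightarrow> ('a \<Rightarrow> 'a \<Rightarrow> real) \<Rightarrow> ('b \<Rightarrow> 'b \<Rightarrow> real) \<Rightarrow> ('a \<times> 'b) set \<Rightarrow> real \<Rightarrow> ennreal" where
  "oscillation X dX dY \<Phi> \<delta> =
     (SUP A\<in>{A. A \<subseteq> X \<and> ediam dX A \<le> ennreal \<delta>}. ediam dY (\<Phi> `` A))"

definition macro_uniform ::
  "'a set \<Rightarrow> ('a \<Rightarrow> 'a \<Rightarrow> real) \<Rightarrow> ('b \<Rightarrow> 'b \<Rightarrow> real) \<Rightarrow> ('a \<times> 'b) set \<Rightarrow> bool" where
  "macro_uniform X dX dY \<Phi> \<longleftrightarrow> (\<forall>\<delta>\<ge>0. oscillation X dX dY \<Phi> \<delta> < \<infinity>)"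

definition multimap :: "'a set \<Rightarrow> 'b set \<Rightarrow> ('a \<times> 'b) set \<Rightarrow> bool" where
  "multimap X Y \<Phi> \<longleftrightarrow> \<Phi> \<subseteq> X \<times> Y"

definition surjective_multimap :: "'a set \<Rightarrow> 'b set \<Rightarrow> ('a \<times> 'b) set \<Rightarrow> bool" where
  "surjective_multimap X Y \<Phi> \<longleftrightarrow> \<Phi> `` X = Y"

definition eps_component :: "'a set \<Rightarrow> ('a \<Rightarrow> 'a \<Rightarrow> real) \<Rightarrow> real \<Rightarrow> 'a \<Rightarrow> 'a set" where
  "eps_component X d \<epsilon> x =
     {y. \<exists>(n::nat) p. (\<forall>i\<le>n. p i \<in> X) \<and> p 0 = x \<and> p n = y \<and>
            (\<forall>i\<in>{1..n}. d (p (i - 1)) (p i) \<le> \<epsilon>)}"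

definition macro_connected :: "'a set \<Rightarrow> ('a \<Rightarrow> 'a \<Rightarrow> real) \<Rightarrow> bool" where
  "macro_connected X d \<longleftrightarrow> (\<exists>x\<in>X. \<exists>\<epsilon>\<ge>0. eps_component X d \<epsilon> x = X)"

end

theory Submission
  imports Defs
begin

text \<open>Fix a base point \<open>x\<^sub>0\<close> of \<open>X\<close> and let the linking rank \<open>f x\<close> of a point be the least
  natural number \<open>n\<close> such that \<open>x\<close> can be reached from \<open>x\<^sub>0\<close> by jumps of length at most \<open>n\<close>.
  A single jump always suffices, so \<open>f\<close> is defined everywhere. Two facts about it carry the proof.

  \<^item> Points at distance at most \<open>m\<close> have the same rank or both have rank at most \<open>m\<close>
    (\<open>linking_rank_near\<close>): the jump between them may be appended to any chain whose jumps are
    allowed length \<open>m\<close> or more.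
  \<^item> If \<open>X\<close> is not macro-connected, then \<open>f\<close> takes infinitely many values
    (\<open>infinite_linking_ranks\<close>): a bound on the ranks would be a single jump length that links
    \<open>x\<^sub>0\<close> to all of \<open>X\<close>.

  Hence a countable dense set \<open>D\<close> of \<open>Y\<close> embeds, by some \<open>e\<close>, into the set of ranks, and \<open>\<Phi>\<close> may
  send \<open>x\<close> to the closed unit ball around the \<open>c \<in> D\<close> with \<open>e c = f x\<close>, if there is one. Density
  makes \<open>\<Phi>\<close> surjective. For points \<open>x, x'\<close> at distance at most \<open>m\<close>, the two centres coincide or
  both belong to the finite set of those \<open>c\<close> with \<open>e c \<le> m\<close>; so the distance between the centres
  is bounded in terms of \<open>m\<close> alone, and \<open>\<Phi>\<close> is macro-uniform.\<close>

text \<open>Oscillation can be bounded by looking at two points at a time, since a set of diameter at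
  most \<open>\<delta>\<close> enters only through the distances between its points.\<close>

lemma macro_uniformI:
  assumes "\<And>\<delta>. \<delta> \<ge> 0 \<Longrightarrow> \<exists>B. \<forall>x y x' y'. (x, y) \<in> \<Phi> \<longrightarrow> (x', y') \<in> \<Phi> \<longrightarrow> dX x x' \<le> \<delta> \<longrightarrow> dY y y' \<le> B"
  shows "macro_uniform X dX dY \<Phi>"
  unfolding macro_uniform_def
proof (intro allI impI)
  fix \<delta> :: real assume \<delta>: "\<delta> \<ge> 0"
  obtain B where B: "\<And>x y x' y'. (x, y) \<in> \<Phi> \<Longrightarrow> (x', y') \<in> \<Phi> \<Longrightarrow> dX x x' \<le> \<delta> \<Longrightarrow> dY y y' \<le> B"
    using assms[OF \<delta>] by blast
  have "oscillation X dX dY \<Phi> \<delta> \<le> ennreal B"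
    unfolding oscillation_def
  proof (rule SUP_least)
    fix A assume "A \<in> {A. A \<subseteq> X \<and> ediam dX A \<le> ennreal \<delta>}"
    then have A: "dX x x' \<le> \<delta>" if "x \<in> A" "x' \<in> A" for x x'
      using that \<delta> by (simp add: ediam_def SUP_le_iff)
    show "ediam dY (\<Phi> `` A) \<le> ennreal B"
      unfolding ediam_def by (intro SUP_least ennreal_leI) (blast intro: B A)
  qed
  also have "\<dots> < \<infinity>" by simp
  finally show "oscillation X dX dY \<Phi> \<delta> < \<infinity>" .
qed

lemma eps_component_subset: "eps_component X d \<epsilon> x \<subseteq> X"
  by (auto simp: eps_component_def)

lemma eps_component_mono: "\<epsilon> \<le> \<epsilon>' \<Longrightarrow> eps_component X d \<epsilon> x \<subseteq> eps_component X d \<epsilon>' x"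
  unfolding eps_component_def by (blast intro: order_trans)

lemma eps_component_refl: "x \<in> X \<Longrightarrow> x \<in> eps_component X d \<epsilon> x"
  unfolding eps_component_def by (intro CollectI exI[of _ 0] exI[of _ "\<lambda>_. x"]) simp

lemma eps_component_step:
  assumes "y \<in> eps_component X d \<epsilon> x" "z \<in> X" "d y z \<le> \<epsilon>"
  shows "z \<in> eps_component X d \<epsilon> x"
proof -
  obtain n :: nat and p where p: "\<forall>i\<le>n. p i \<in> X" "p 0 = x" "p n = y"
      "\<forall>i\<in>{1..n}. d (p (i - 1)) (p i) \<le> \<epsilon>"
    using assms(1) unfolding eps_component_def mem_Collect_eq by blast
  let ?q = "p(Suc n := z)"
  have "\<forall>i\<le>Suc n. ?q i \<in> X" "?q 0 = x" "?q (Suc n) = z"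
    using p assms(2) by (auto simp: le_Suc_eq)
  moreover have "\<forall>i\<in>{1..Suc n}. d (?q (i - 1)) (?q i) \<le> \<epsilon>"
    using p assms(3) by (auto simp: le_Suc_eq)
  ultimately show ?thesis
    unfolding eps_component_def by blast
qed

definition linking_rank :: "'a set \<Rightarrow> ('a \<Rightarrow> 'a \<Rightarrow> real) \<Rightarrow> 'a \<Rightarrow> 'a \<Rightarrow> nat" where
  "linking_rank X d x0 x = (LEAST n. x \<in> eps_component X d (real n) x0)"

text \<open>The least element in the definition exists because \<open>x0\<close> and \<open>x\<close> are linked by one jump of
  length \<open>d x0 x\<close>.\<close>

lemma linking_rank_le_iff:
  assumes "x0 \<in> X" "x \<in> X"
  shows "linking_rank X d x0 x \<le> n \<longleftrightarrow> x \<in> eps_component X d (real n) x0"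
proof
  obtain m where "d x0 x \<le> real m"
    using real_arch_simple by blast
  then have "x \<in> eps_component X d (real m) x0"
    using assms by (blast intro: eps_component_step eps_component_refl)
  then have "x \<in> eps_component X d (real (linking_rank X d x0 x)) x0"
    unfolding linking_rank_def by (rule LeastI)
  moreover assume "linking_rank X d x0 x \<le> n"
  ultimately show "x \<in> eps_component X d (real n) x0"
    by (meson eps_component_mono of_nat_mono subsetD)
next
  assume "x \<in> eps_component X d (real n) x0"
  then show "linking_rank X d x0 x \<le> n"
    unfolding linking_rank_def by (rule Least_le)
qed

text \<open>This is an ultrametric phenomenon: one more jump of length at most \<open>m\<close> does not increase a
  rank that is already \<open>m\<close> or more.\<close>

lemma linking_rank_le_max:
  assumes "x0 \<in> X" "x \<in> X" "y \<in> X" "d x y \<le> real m"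
  shows "linking_rank X d x0 y \<le> max (linking_rank X d x0 x) m"
proof -
  let ?n = "max (linking_rank X d x0 x) m"
  have "x \<in> eps_component X d (real ?n) x0"
    using linking_rank_le_iff[OF assms(1,2), of d ?n] by simp
  moreover have "d x y \<le> real ?n"
    using assms(4) by simp
  ultimately have "y \<in> eps_component X d (real ?n) x0"
    using assms(3) by (blast intro: eps_component_step)
  then show ?thesis
    using linking_rank_le_iff[OF assms(1,3)] by blast
qed

lemma linking_rank_near:
  assumes "Metric_space X d" "x0 \<in> X" "x \<in> X" "y \<in> X" "d x y \<le> real m"
  shows "linking_rank X d x0 x = linking_rank X d x0 y
    \<or> linking_rank X d x0 x \<le> m \<and> linking_rank X d x0 y \<le> m"
proof -
  have "d y x \<le> real m"
    using assms(1,5) by (simp add: Metric_space.commute)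
  then show ?thesis
    using linking_rank_le_max[of x0 X x y d m] linking_rank_le_max[of x0 X y x d m] assms
    by (auto simp: max_def split: if_splits)
qed

lemma infinite_linking_ranks:
  assumes "x0 \<in> X" "\<not> macro_connected X d"
  shows "infinite (linking_rank X d x0 ` X)"
proof
  assume "finite (linking_rank X d x0 ` X)"
  then obtain N where N: "\<forall>x\<in>X. linking_rank X d x0 x \<le> N"
    by (auto simp: finite_nat_set_iff_bounded_le)
  then have "X \<subseteq> eps_component X d (real N) x0"
    using linking_rank_le_iff[OF assms(1)] by blast
  then have "eps_component X d (real N) x0 = X"
    using eps_component_subset by fast
  then show False
    using assms by (auto simp: macro_connected_def)
qed

lemma countable_embeds_in_infinite_nat_set:
  fixes S :: "nat set"
  assumes "countable D" "infinite S"
  obtains e where "inj_on e D" "e ` D \<subseteq> S"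
proof
  show "inj_on (enumerate S \<circ> to_nat_on D) D"
    using assms by (intro comp_inj_on inj_on_to_nat_on)
      (auto intro: inj_on_subset[OF bij_betw_imp_inj_on[OF bij_enumerate]])
  show "(enumerate S \<circ> to_nat_on D) ` D \<subseteq> S"
    using assms(2) by (auto intro: enumerate_in_set)
qed

lemma (in Metric_space) separable_space_net:
  assumes "separable_space mtopology" "0 < r"
  obtains D where "countable D" "D \<subseteq> M" "\<And>y. y \<in> M \<Longrightarrow> \<exists>c\<in>D. d c y \<le> r"
proof -
  obtain D where D: "countable D" "D \<subseteq> M" "mtopology closure_of D = M"
    using assms(1) by (auto simp: separable_space_def)
  have "\<exists>c\<in>D. d c y \<le> r" if "y \<in> M" for y
  proof -
    have "y \<in> mtopology closure_of D"
      using D(3) that by simp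
    then obtain c where "c \<in> D" "c \<in> mball y r"
      unfolding metric_closure_of using assms(2) by blast
    then show ?thesis
      by (metis commute in_mball less_imp_le)
  qed
  with D show thesis
    using that by blast
qed

theorem theorem5:
  fixes X :: "'a set" and dX :: "'a \<Rightarrow> 'a \<Rightarrow> real"
    and Y :: "'b set" and dY :: "'b \<Rightarrow> 'b \<Rightarrow> real"
  assumes "Metric_space X dX" and "X \<noteq> {}"
    and "\<not> macro_connected X dX"
    and "Metric_space Y dY"
    and "separable_space (Metric_space.mtopology Y dY)"
  shows "\<exists>\<Phi>. multimap X Y \<Phi> \<and> surjective_multimap X Y \<Phi> \<and> macro_uniform X dX dY \<Phi>"
proof -
  interpret Y: Metric_space Y dY by fact
  obtain x0 where x0: "x0 \<in> X"
    using assms(2) by blast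
  define f where "f = linking_rank X dX x0"
  obtain D where D: "countable D" "D \<subseteq> Y" "\<And>y. y \<in> Y \<Longrightarrow> \<exists>c\<in>D. dY c y \<le> 1"
    using Y.separable_space_net[OF assms(5), of 1] by auto
  have "infinite (f ` X)"
    unfolding f_def using x0 assms(3) by (rule infinite_linking_ranks)
  then obtain e where e: "inj_on e D" "e ` D \<subseteq> f ` X"
    using D(1) countable_embeds_in_infinite_nat_set by blast
  define \<Phi> where "\<Phi> = {(x, y). x \<in> X \<and> y \<in> Y \<and> (\<exists>c\<in>D. e c = f x \<and> dY c y \<le> 1)}"
  have "multimap X Y \<Phi>"
    by (auto simp: multimap_def \<Phi>_def)
  moreover have "surjective_multimap X Y \<Phi>"
    unfolding surjective_multimap_def
  proof
    show "\<Phi> `` X \<subseteq> Y"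
      by (auto simp: \<Phi>_def)
    show "Y \<subseteq> \<Phi> `` X"
    proof
      fix y assume y: "y \<in> Y"
      then obtain c where c: "c \<in> D" "dY c y \<le> 1"
        using D(3) by blast
      then obtain x where "x \<in> X" "e c = f x"
        using e(2) by blast
      with c y show "y \<in> \<Phi> `` X"
        by (auto simp: \<Phi>_def)
    qed
  qed
  moreover have "macro_uniform X dX dY \<Phi>"
  proof (rule macro_uniformI)
    fix \<delta> :: real
    obtain m where m: "\<delta> \<le> real m"
      using real_arch_simple by blast
    define F where "F = {c \<in> D. e c \<le> m}"
    have "finite F"
      using finite_vimage_IntI[OF finite_atMost[of m] e(1)]
      by (rule rev_finite_subset) (auto simp: F_def)
    \<comment> \<open>The inserted \<open>0\<close> covers the case of equal centres.\<close>
    define R where "R = Max (insert 0 (case_prod dY ` (F \<times> F)))"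
    have R: "0 \<le> R" "\<And>c c'. c \<in> F \<Longrightarrow> c' \<in> F \<Longrightarrow> dY c c' \<le> R"
      unfolding R_def using \<open>finite F\<close> by (auto intro!: Max_ge)
    have "dY y y' \<le> R + 2" if xy: "(x, y) \<in> \<Phi>" "(x', y') \<in> \<Phi>" and \<delta>: "dX x x' \<le> \<delta>" for x y x' y'
    proof -
      obtain c c' where c: "c \<in> D" "e c = f x" "dY c y \<le> 1" and c': "c' \<in> D" "e c' = f x'" "dY c' y' \<le> 1"
        using xy by (auto simp: \<Phi>_def)
      have X: "x \<in> X" "x' \<in> X" and Y: "y \<in> Y" "y' \<in> Y" "c \<in> Y" "c' \<in> Y"
        using xy c(1) c'(1) D(2) by (auto simp: \<Phi>_def)
      have "f x = f x' \<or> f x \<le> m \<and> f x' \<le> m"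
        unfolding f_def using assms(1) x0 X order_trans[OF \<delta> m] by (rule linking_rank_near)
      then have "c = c' \<or> c \<in> F \<and> c' \<in> F"
        using c c' inj_on_eq_iff[OF e(1) c(1) c'(1)] by (auto simp: F_def)
      then have "dY c c' \<le> R"
        using R Y by auto
      moreover have "dY y y' \<le> dY y c + dY c c' + dY c' y'"
        using Y.triangle[OF Y(1,3,2)] Y.triangle[OF Y(3,4,2)] by linarith
      ultimately show ?thesis
        using c(3) c'(3) Y.commute[of y c] by linarith
    qed
    then show "\<exists>B. \<forall>x y x' y'. (x, y) \<in> \<Phi> \<longrightarrow> (x', y') \<in> \<Phi> \<longrightarrow> dX x x' \<le> \<delta> \<longrightarrow> dY y y' \<le> B"
      by blast
  qed
  ultimately show ?thesis
    by blast
qed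

end
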